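(* Let $\epsilon\in[0,1]$, let $N=2^n$, and let $\eta$ be a threshold parameter between $0$ and $1$. Consider the quantum polar code of block length $N$ (described in the context) built with the same threshold $\eta$ for its amplitude and phase parts, used over $N$ independent uses of the quantum erasure channel $\rho\mapsto(1-\epsilon)\rho+\epsilon|e\rangle\langle e|$. Let $W$ be the classical binary erasure channel with erasure probability $\epsilon$, let $W_N^{(i)}$ ($1\le i\le N$) be its synthesized (split) channels, let $Z(\cdot)$ be the Bhattacharyya parameter, let $\mathcal{A}(\eta)=\{i\in\{1,\dots,N\}: Z(W_N^{(i)})\le\eta\}$, and put $$U(\eta)=\sum_{i\in\mathcal{A}(\eta)}Z(W_N^{(i)}),\qquad L(\eta)=\max_{i\in\mathcal{A}(\eta)}\frac12\left(1-\sqrt{1-Z(W_N^{(i)})^2}\right).$$ Let $P_e=\Pr\{\alpha_{\mathrm{err}}\}+\Pr\{\phi_{\mathrm{err}}\}-\Pr\{\alpha_{\mathrm{err}},\phi_{\mathrm{err}}\}$ be the block error probability of the code, where $\alpha_{\mathrm{err}}$ and $\phi_{\mathrm{err}}$ are the events that, in a run of the code, an error occurs during the decoding of the induced amplitude channel and of the induced phase channel, respectively. Then $$L(\eta)\,\bigl(2-U(\eta)\bigr)\;\le\;P_e\;\le\;U(\eta)\,\bigl(2-L(\eta)\bigr).$$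
   Context: **Synthesized channels.** A binary-input classical channel $V$ with transition probabilities $V(y|x)$, $x\in\{0,1\}$, has Bhattacharyya parameter $Z(V)=\sum_y\sqrt{V(y|0)V(y|1)}$. The binary erasure channel $W$ with erasure probability $\epsilon$ outputs its input bit with probability $1-\epsilon$ and an erasure symbol with probability $\epsilon$. For $N=2^n$ let $G_N=B_NF^{\otimes n}$ over $\mathbb{F}_2$, where $F=\begin{pmatrix}1&0\\1&1\end{pmatrix}$ and $B_N$ is the bit-reversal permutation matrix (Arikan's encoding matrix). For a row vector $u^N\in\mathbb{F}_2^N$ let $W_N(y^N|u^N)=\prod_{j=1}^N W(y_j|(u^NG_N)_j)$. The $i$-th synthesized channel has input $u_i$ and output $(y^N,u_1^{i-1})$: $$W_N^{(i)}(y^N,u_1^{i-1}|u_i)=\sum_{u_{i+1}^N\in\{0,1\}^{N-i}}\frac{1}{2^{N-1}}W_N(y^N|u^N).$$ **Successive cancellation (SC) decoding.** Given an information set $\mathcal{A}\subseteq\{1,\dots,N\}$, $u^N$ is uniformly random on $\{0,1\}^N$, the bits $u_i$ with $i\notin\mathcal{A}$ ("frozen") are known to the receiver, $u^NG_N$ is sent over $N$ uses of $W$, and $y^N$ is received. The decoder computes $\hat u_1,\dots,\hat u_N$ in order: $\hat u_i=u_i$ if $i\notin\mathcal{A}$; if $i\in\mathcal{A}$, $\hat u_i=0$ when $W_N^{(i)}(y^N,\hat u_1^{i-1}|0)\ge W_N^{(i)}(y^N,\hat u_1^{i-1}|1)$ and $\hat u_i=1$ otherwise. A decoding error is the event $\hat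 u^N\neq u^N$. **The quantum polar code.** A qubit channel $\mathcal{N}$ induces the amplitude channel $z\mapsto\mathcal{N}(|z\rangle\langle z|)$ and the phase channel $x\mapsto(\mathcal{N}\otimes I)(\sigma_Z^x|\Phi\rangle\langle\Phi|\sigma_Z^x)$, where $\sigma_Z$ is the Pauli $Z$ operator acting on the sender's share (the first qubit) and $|\Phi\rangle=2^{-1/2}(|00\rangle+|11\rangle)$. For the quantum erasure channel (where $|e\rangle$ is an erasure flag orthogonal to the qubit space), both induced channels are classical binary erasure channels with erasure probability $\epsilon$. The sender applies the CNOT circuit that implements $u^N\mapsto u^NG_N$ on the computational basis. In the phase basis the CNOT gates act in reverse, so the order of the synthesized channels is preserved for the amplitude channel but reversed for the phase channel: encoder input $N+1-i$ sees, in the phase basis, the synthesized channel $W_N^{(i)}$. The amplitude information ("good") set is $\mathcal{A}(\eta)$ and the phase information set is $\{N+1-i: i\in\mathcal{A}(\eta)\}$. Encoder inputs good in both amplitude and phase carry information qubits; those bad in amplitude and good in phase carry $|0\rangle$; those good in amplitude and bad in phase carry $|+\rangle=2^{-1/2}(|0\rangle+|1\rangle)$; those bad in both carry halves of $|\Phi\rangle$ shared with the receiver. The receiver performs a coherent version of SC decoding for the amplitude channel, sends the coherently decoded qubits through the inverse of the coherent encoder, which induces the phase channel from the point of view of the phase basis of the encoder inputs, and then performs a coherent version of SC decoding for the phase channel (in the reversed order $N,N-1,\dots,1$), followed by CNOT gates from the register holding the amplitude outcomes to the register holding the phase outcomes. **Error events.** In a run of the code, $\alpha_{\mathrm{err}}$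 is the event of a decoding error in the SC decoding of the induced amplitude channel with information set $\mathcal{A}(\eta)$, and $\phi_{\mathrm{err}}$ is the event of a decoding error in the SC decoding of the induced phase channel with information set $\{N+1-i: i\in\mathcal{A}(\eta)\}$. Thus a block error is counted when either an amplitude or a phase decoding error occurs. The maximum over an empty set is taken to be $0$. *)

theory Defs
  imports "HOL-Probability.Probability" "HOL-Library.Z2"
begin

instance bit :: finite
proof
  have "(UNIV :: bit set) = {0, 1}"
    by (auto intro: bit.exhaust)
  then show "finite (UNIV :: bit set)"
    by (metis finite.emptyI finite.insertI)
qed

section \<open>Classical channels, the polar transform and successive cancellation\<close>

text \<open>
  A binary-input channel is given by its transition probabilities \<open>V y x\<close>.  Blocks are lists.
  Entry \<open>u ! (i - 1)\<close> is the bit \<open>u\<^sub>i\<close>: list and matrix positions count from 0, whereas inputs of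
  the code, information sets and synthesized channels are numbered by \<open>i \<in> {1..N}\<close>.
\<close>

definition bhattacharyya :: "'y set \<Rightarrow> ('y \<Rightarrow> bit \<Rightarrow> real) \<Rightarrow> real" where
  "bhattacharyya Y V = (\<Sum>y\<in>Y. sqrt (V y 0 * V y 1))"

definition bec :: "real \<Rightarrow> bit option \<Rightarrow> bit \<Rightarrow> real" where
  "bec \<epsilon> y x = (case y of None \<Rightarrow> \<epsilon> | Some b \<Rightarrow> if b = x then 1 - \<epsilon> else 0)"

definition polar_kernel :: "nat \<Rightarrow> nat \<Rightarrow> bit" where
  "polar_kernel i j = (if i = 0 \<and> j = 1 then 0 else 1)"

text \<open>The entries of the \<open>n\<close>-fold Kronecker power; the leading bit of an index of
  \<open>{..<2 ^ Suc n}\<close> is its position in the first factor.\<close>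
primrec kernel_power :: "nat \<Rightarrow> nat \<Rightarrow> nat \<Rightarrow> bit" where
  "kernel_power 0 i j = 1"
| "kernel_power (Suc n) i j =
     polar_kernel (i div 2 ^ n) (j div 2 ^ n) * kernel_power n (i mod 2 ^ n) (j mod 2 ^ n)"

text \<open>Reversal of the \<open>n\<close>-bit binary expansion of an index.\<close>
primrec bit_rev :: "nat \<Rightarrow> nat \<Rightarrow> nat" where
  "bit_rev 0 i = 0"
| "bit_rev (Suc n) i = (i mod 2) * 2 ^ n + bit_rev n (i div 2)"

definition bit_rev_matrix :: "nat \<Rightarrow> nat \<Rightarrow> nat \<Rightarrow> bit" where
  "bit_rev_matrix n i j = (if j = bit_rev n i then 1 else 0)"

definition polar_matrix :: "nat \<Rightarrow> nat \<Rightarrow> nat \<Rightarrow> bit" where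
  "polar_matrix n i j = (\<Sum>k<2 ^ n. bit_rev_matrix n i k * kernel_power n k j)"

definition polar_encode :: "nat \<Rightarrow> bit list \<Rightarrow> bit list" where
  "polar_encode n u = map (\<lambda>j. \<Sum>i<2 ^ n. u ! i * polar_matrix n i j) [0..<2 ^ n]"

definition memoryless :: "nat \<Rightarrow> ('y \<Rightarrow> bit \<Rightarrow> real) \<Rightarrow> 'y list \<Rightarrow> bit list \<Rightarrow> real" where
  "memoryless N V y x = (\<Prod>j<N. V (y ! j) (x ! j))"

text \<open>The \<open>i\<close>-th synthesized channel of a block channel \<open>P\<close> with \<open>N\<close> input bits.\<close>
definition synth :: "nat \<Rightarrow> ('y list \<Rightarrow> bit list \<Rightarrow> real) \<Rightarrow> nat \<Rightarrow> 'y list \<times> bit list \<Rightarrow> bit \<Rightarrow> real" where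
  "synth N P i = (\<lambda>(y, p) b. \<Sum>s | length s = N - i. 1 / 2 ^ (N - 1) * P y (p @ b # s))"

definition synth_outputs :: "nat \<Rightarrow> nat \<Rightarrow> ('y list \<times> bit list) set" where
  "synth_outputs N i = {y. length y = N} \<times> {p. length p = i - 1}"

text \<open>\<open>sc_prefix N P A u y k\<close> are the first \<open>k\<close> decisions of the decoder; it reads only the
  entries of \<open>u\<close> outside the information set \<open>A\<close>.\<close>
primrec sc_prefix ::
    "nat \<Rightarrow> ('y list \<Rightarrow> bit list \<Rightarrow> real) \<Rightarrow> nat set \<Rightarrow> bit list \<Rightarrow> 'y list \<Rightarrow> nat \<Rightarrow> bit list" where
  "sc_prefix N P A u y 0 = []"
| "sc_prefix N P A u y (Suc k) =
     (let p = sc_prefix N P A u y k in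
      p @ [if Suc k \<notin> A then u ! k
           else if synth N P (Suc k) (y, p) 0 \<ge> synth N P (Suc k) (y, p) 1 then 0 else 1])"

definition sc_decode ::
    "nat \<Rightarrow> ('y list \<Rightarrow> bit list \<Rightarrow> real) \<Rightarrow> nat set \<Rightarrow> bit list \<Rightarrow> 'y list \<Rightarrow> bit list" where
  "sc_decode N P A u y = sc_prefix N P A u y N"

section \<open>The quantum erasure channel and its induced channels\<close>

text \<open>
  The computational basis of a qubit is indexed by \<^typ>\<open>bit\<close>, that of the output space of the
  erasure channel by \<^typ>\<open>bit option\<close>, where \<^term>\<open>None\<close> stands for the erasure flag.
\<close>

type_synonym 'a operator = "complex ^ 'a ^ 'a"

definition ket :: "'a::finite \<Rightarrow> complex ^ 'a" where
  "ket a = axis a 1"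

definition projector :: "complex ^ 'a \<Rightarrow> ('a::finite) operator" where
  "projector \<psi> = (\<chi> i j. \<psi> $ i * cnj (\<psi> $ j))"

definition tensor :: "('a::finite) operator \<Rightarrow> ('b::finite) operator \<Rightarrow> ('a \<times> 'b) operator" where
  "tensor A B = (\<chi> p q. A $ fst p $ fst q * B $ snd p $ snd q)"

text \<open>The factor \<^term>\<open>trace \<rho>\<close> is the linear extension from density operators.\<close>
definition erasure_channel :: "real \<Rightarrow> bit operator \<Rightarrow> (bit option) operator" where
  "erasure_channel \<epsilon> \<rho> = (\<chi> a b. case (a, b) of
       (Some x, Some y) \<Rightarrow> (1 - of_real \<epsilon>) * \<rho> $ x $ y
     | (None, None) \<Rightarrow> of_real \<epsilon> * trace \<rho>
     | _ \<Rightarrow> 0)"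

text \<open>\<open>\<N> \<otimes> I\<close>, applied to each block of matrix entries with fixed second coordinates.\<close>
definition channel_on_first ::
    "(('a::finite) operator \<Rightarrow> ('b::finite) operator) \<Rightarrow>
     ('a \<times> 'r::finite) operator \<Rightarrow> ('b \<times> 'r) operator" where
  "channel_on_first \<N> \<rho> =
     (\<chi> p q. \<N> (\<chi> a b. \<rho> $ (a, snd p) $ (b, snd q)) $ fst p $ fst q)"

definition max_entangled :: "complex ^ (bit \<times> bit)" where
  "max_entangled = (1 / complex_of_real (sqrt 2)) *s (ket (0, 0) + ket (1, 1))"

definition pauli_Z :: "bit operator" where
  "pauli_Z = (\<chi> i j. if i = j then (if i = 0 then 1 else - 1) else 0)"

definition phase_flip :: "bit \<Rightarrow> bit operator" where
  "phase_flip x = (if x = 1 then pauli_Z else mat 1)"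

definition phase_bell :: "bit \<Rightarrow> complex ^ (bit \<times> bit)" where
  "phase_bell x = tensor (phase_flip x) (mat 1) *v max_entangled"

definition amplitude_channel ::
    "(bit operator \<Rightarrow> ('b::finite) operator) \<Rightarrow> bit \<Rightarrow> 'b operator" where
  "amplitude_channel \<N> z = \<N> (projector (ket z))"

definition phase_channel ::
    "(bit operator \<Rightarrow> ('b::finite) operator) \<Rightarrow> bit \<Rightarrow> ('b \<times> bit) operator" where
  "phase_channel \<N> x = channel_on_first \<N> (projector (phase_bell x))"

definition born :: "('a::finite) operator \<Rightarrow> 'a operator \<Rightarrow> real" where
  "born E \<rho> = Re (trace (E ** \<rho>))"

text \<open>
  The output states of each induced channel commute; the projective measurements below, which
  contain the test for the erasure flag, resolve them.  \<open>embed_first\<close> includes the qubit space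
  in the output space of the erasure channel.
\<close>

definition amplitude_measurement :: "bit option \<Rightarrow> (bit option) operator" where
  "amplitude_measurement y = projector (ket y)"

definition embed_first :: "complex ^ (bit \<times> bit) \<Rightarrow> complex ^ (bit option \<times> bit)" where
  "embed_first \<psi> = (\<chi> p. case fst p of None \<Rightarrow> 0 | Some a \<Rightarrow> \<psi> $ (a, snd p))"

definition phase_measurement :: "bit option \<Rightarrow> (bit option \<times> bit) operator" where
  "phase_measurement y = (case y of
       None \<Rightarrow> tensor (projector (ket None)) (mat 1)
     | Some b \<Rightarrow> projector (embed_first (phase_bell b)))"

definition amplitude_trans :: "real \<Rightarrow> bit option \<Rightarrow> bit \<Rightarrow> real" where
  "amplitude_trans \<epsilon> y z =
     born (amplitude_measurement y) (amplitude_channel (erasure_channel \<epsilon>) z)"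

definition phase_trans :: "real \<Rightarrow> bit option \<Rightarrow> bit \<Rightarrow> real" where
  "phase_trans \<epsilon> y x =
     born (phase_measurement y) (phase_channel (erasure_channel \<epsilon>) x)"

lemma UNIV_bit: "(UNIV :: bit set) = {0, 1}"
  by (auto intro: bit.exhaust)

lemma UNIV_bit_option: "(UNIV :: bit option set) = {None, Some 0, Some 1}"
  by (auto simp: UNIV_option_conv UNIV_bit)

lemma sum_bit: "(\<Sum>b\<in>UNIV. f b) = f (0::bit) + f 1"
  by (simp add: UNIV_bit)

lemma sum_bit_option: "(\<Sum>b\<in>UNIV. f b) = f None + f (Some (0::bit)) + f (Some 1)"
  by (simp add: UNIV_bit_option algebra_simps)

lemma sum_prod_UNIV:
  "(\<Sum>p\<in>UNIV. f p) = (\<Sum>a\<in>(UNIV::'a::finite set). \<Sum>b\<in>(UNIV::'b::finite set). f (a, b))"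
  by (simp add: sum.cartesian_product)

lemma amplitude_trans_bec: "amplitude_trans \<epsilon> = bec \<epsilon>"
proof (intro ext)
  fix y z
  show "amplitude_trans \<epsilon> y z = bec \<epsilon> y z"
    by (cases y; cases z; cases "the y")
      (auto simp: amplitude_trans_def bec_def born_def amplitude_measurement_def
        amplitude_channel_def erasure_channel_def projector_def ket_def trace_def
        matrix_matrix_mult_def axis_def sum_bit sum_bit_option)
qed

lemma phase_bell_nth:
  "phase_bell x $ (a, b) =
     (if a = b then (if a = 1 \<and> x = 1 then - 1 else 1) / complex_of_real (sqrt 2) else 0)"
  by (cases x; cases a; cases b)
    (auto simp: phase_bell_def phase_flip_def pauli_Z_def tensor_def max_entangled_def
      matrix_vector_mult_def ket_def axis_def mat_def sum_prod_UNIV sum_bit)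

lemma phase_trans_bec: "phase_trans \<epsilon> = bec \<epsilon>"
proof (intro ext)
  fix y x
  have s: "complex_of_real (sqrt 2) * complex_of_real (sqrt 2) = 2"
    by (simp flip: of_real_mult)
  show "phase_trans \<epsilon> y x = bec \<epsilon> y x"
    by (cases y; cases x; cases "the y")
      (auto simp: phase_trans_def bec_def born_def phase_measurement_def embed_first_def
        phase_channel_def channel_on_first_def erasure_channel_def projector_def ket_def trace_def
        matrix_matrix_mult_def axis_def tensor_def mat_def sum_prod_UNIV sum_bit sum_bit_option
        phase_bell_nth s field_simps)
qed

section \<open>The two block channels of the polar code\<close>

text \<open>
  The CNOT circuit acts linearly on state vectors (complex functions on the basis labels) by
  \<open>|u\<rangle> \<mapsto> |u G\<rangle>\<close>, which determines its action on the phase basis.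
\<close>

definition encode_state :: "nat \<Rightarrow> (bit list \<Rightarrow> complex) \<Rightarrow> bit list \<Rightarrow> complex" where
  "encode_state n \<psi> x = (\<Sum>u | length u = 2 ^ n \<and> polar_encode n u = x. \<psi> u)"

definition phase_basis :: "nat \<Rightarrow> bit list \<Rightarrow> bit list \<Rightarrow> complex" where
  "phase_basis N v u =
     (if (\<Sum>i<N. u ! i * v ! i) = 1 then - 1 else 1) / complex_of_real (sqrt (2 ^ N))"

definition phase_encode :: "nat \<Rightarrow> bit list \<Rightarrow> bit list" where
  "phase_encode n v = map (\<lambda>j. \<Sum>i<2 ^ n. v ! i * polar_matrix n j i) [0..<2 ^ n]"

lemma length_polar_encode [simp]: "length (polar_encode n u) = 2 ^ n"
  by (simp add: polar_encode_def)

lemma length_phase_encode [simp]: "length (phase_encode n u) = 2 ^ n"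
  by (simp add: phase_encode_def)

lemma sum_lessThan_add:
  fixes f :: "nat \<Rightarrow> 'a::comm_monoid_add"
  shows "(\<Sum>k<m + p. f k) = (\<Sum>k<m. f k) + (\<Sum>k<p. f (m + k))"
  by (induction p) (auto simp: add.assoc)

text \<open>Stated over arbitrary semirings, since over \<^typ>\<open>bit\<close> the simplifier turns sums of products
  into cardinalities.\<close>

lemma sum_two_blocks:
  fixes a b c d :: "'a::comm_semiring_1"
  shows "(\<Sum>k<m. (a * f k) * (b * g k)) + (\<Sum>k<m. (c * f k) * (d * g k))
    = (a * b + c * d) * (\<Sum>k<m::nat. f k * g k)"
  by (simp add: sum_distrib_left sum.distrib algebra_simps)

lemma sum_delta_mult:
  fixes f :: "nat \<Rightarrow> 'a::comm_semiring_1"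
  assumes "r < m"
  shows "(\<Sum>k<m. (if k = r then 1 else 0) * f k) = f r"
    and "(\<Sum>k<m. f k * (if k = r then 1 else 0)) = f r"
  using assms by (simp_all add: if_distrib[of "\<lambda>x. x * _"] if_distrib[of "\<lambda>x. _ * x"] cong: if_cong)

lemma sum_matrix_assoc:
  fixes u :: "nat \<Rightarrow> 'a::comm_semiring_1"
  shows "(\<Sum>k<m. (\<Sum>i<m. u i * M i k) * L k) = (\<Sum>i<m. u i * (\<Sum>k<m. M i k * L k))"
  by (simp add: sum_distrib_left sum_distrib_right mult.assoc) (rule sum.swap)

lemma kernel_power_square:
  "i < 2 ^ n \<Longrightarrow> j < 2 ^ n \<Longrightarrow>
    (\<Sum>k<2 ^ n. kernel_power n i k * kernel_power n k j) = (if i = j then 1 else 0)"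
proof (induction n arbitrary: i j)
  case (Suc n)
  let ?m = "2 ^ n :: nat"
  have div: "i div ?m < 2" "j div ?m < 2"
    using Suc.prems by (auto simp: less_mult_imp_div_less)
  have eq: "i = j \<longleftrightarrow> i div ?m = j div ?m \<and> i mod ?m = j mod ?m"
    by (metis div_mult_mod_eq)
  have dd: "(?m + k) div ?m = 1" if "k < ?m" for k
    using that by simp
  have "(\<Sum>k<2 ^ Suc n. kernel_power (Suc n) i k * kernel_power (Suc n) k j)
     = (\<Sum>k<?m + ?m. kernel_power (Suc n) i k * kernel_power (Suc n) k j)"
    by (simp add: mult_2)
  also have "\<dots> = (polar_kernel (i div ?m) 0 * polar_kernel 0 (j div ?m)
        + polar_kernel (i div ?m) 1 * polar_kernel 1 (j div ?m))
      * (\<Sum>k<?m. kernel_power n (i mod ?m) k * kernel_power n k (j mod ?m))"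
    unfolding sum_lessThan_add sum_two_blocks[symmetric]
    by (intro arg_cong2[where f = "(+)"] sum.cong) (simp_all add: dd)
  also have "\<dots> = (polar_kernel (i div ?m) 0 * polar_kernel 0 (j div ?m)
        + polar_kernel (i div ?m) 1 * polar_kernel 1 (j div ?m))
      * (if i mod ?m = j mod ?m then 1 else 0)"
    by (subst Suc.IH) auto
  also have "\<dots> = (if i = j then 1 else 0)"
    using div unfolding eq
    by (auto simp: polar_kernel_def less_2_cases_iff)
  finally show ?case .
qed auto

lemma kernel_power_bits:
  "i < 2 ^ n \<Longrightarrow> j < 2 ^ n \<Longrightarrow>
    kernel_power n i j = (if \<forall>b<n. bit j b \<longrightarrow> bit i b then 1 else 0)"
proof (induction n arbitrary: i j)
  case (Suc n)
  have d: "i div 2 ^ n < 2" "j div 2 ^ n < 2"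
    using Suc.prems by (auto simp: less_mult_imp_div_less)
  have b: "bit k n \<longleftrightarrow> k div 2 ^ n = 1" if "k div 2 ^ n < 2" for k :: nat
    using that by (auto simp: bit_iff_odd less_2_cases_iff)
  have m: "bit (k mod 2 ^ n) b \<longleftrightarrow> bit k b" if "b < n" for k b :: nat
    using that by (metis bit_take_bit_iff take_bit_eq_mod)
  show ?case
    using d b[OF d(1)] b[OF d(2)]
    by (simp add: Suc.IH m polar_kernel_def less_Suc_eq all_conj_distrib)
qed auto

lemma bit_rev_less: "bit_rev n i < 2 ^ n"
proof (induction n arbitrary: i)
  case (Suc n)
  have "i mod 2 = 0 \<or> i mod 2 = 1"
    by auto
  then show ?case
    using Suc[of "i div 2"] by auto
qed auto

lemma bit_bit_rev: "bit (bit_rev n i) b \<longleftrightarrow> b < n \<and> bit i (n - 1 - b)"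
proof (induction n arbitrary: i b)
  case (Suc n)
  have lt: "bit_rev n (i div 2) < 2 ^ n"
    by (rule bit_rev_less)
  consider "b < n" | "b = n" | "b > n"
    by linarith
  then show ?case
  proof cases
    case 1
    have "bit (bit_rev (Suc n) i) b \<longleftrightarrow> bit (bit_rev (Suc n) i mod 2 ^ n) b"
      using 1 by (metis bit_take_bit_iff take_bit_eq_mod)
    also have "bit_rev (Suc n) i mod 2 ^ n = bit_rev n (i div 2)"
      using lt by simp
    finally show ?thesis
      using 1 Suc[of "i div 2" b] by (simp add: Suc_diff_Suc flip: bit_Suc)
  next
    case 2
    have "bit_rev (Suc n) i div 2 ^ n = i mod 2"
      using lt by simp
    then show ?thesis
      using 2 by (simp add: bit_iff_odd del: bit_rev.simps)
  next
    case 3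
    have "bit_rev (Suc n) i < 2 ^ b"
      using bit_rev_less[of "Suc n" i] 3
      by (meson Suc_leI less_le_trans one_le_numeral power_increasing)
    then show ?thesis
      using 3 by (simp add: bit_iff_odd del: bit_rev.simps)
  qed
qed auto

lemma bit_rev_bit_rev: "i < 2 ^ n \<Longrightarrow> bit_rev n (bit_rev n i) = i"
proof (rule bit_eqI)
  fix b assume "i < 2 ^ n"
  then have "bit i b \<Longrightarrow> b < n"
    by (metis bit_take_bit_iff take_bit_nat_eq_self)
  then show "bit (bit_rev n (bit_rev n i)) b \<longleftrightarrow> bit i b"
    by (auto simp: bit_bit_rev)
qed

lemma kernel_power_bit_rev:
  assumes "i < 2 ^ n" "j < 2 ^ n"
  shows "kernel_power n (bit_rev n i) j = kernel_power n i (bit_rev n j)"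
proof -
  have "(\<forall>b<n. bit j b \<longrightarrow> bit i (n - Suc b)) \<longleftrightarrow> (\<forall>b<n. bit j (n - Suc b) \<longrightarrow> bit i b)"
    by (auto dest: spec[of _ "n - Suc _"])
  then show ?thesis
    using assms by (simp add: kernel_power_bits bit_rev_less bit_bit_rev)
qed

lemma polar_matrix_eq: "polar_matrix n i j = kernel_power n (bit_rev n i) j"
  unfolding polar_matrix_def bit_rev_matrix_def by (rule sum_delta_mult(1)[OF bit_rev_less])

lemma polar_matrix_square:
  assumes "i < 2 ^ n" "j < 2 ^ n"
  shows "(\<Sum>k<2 ^ n. polar_matrix n i k * polar_matrix n k j) = (if i = j then 1 else 0)"
proof -
  have "(\<Sum>k<2 ^ n. polar_matrix n i k * polar_matrix n k j)
      = (\<Sum>k<2 ^ n. kernel_power n i (bit_rev n k) * kernel_power n (bit_rev n k) j)"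
    using assms by (intro sum.cong) (auto simp only: polar_matrix_eq kernel_power_bit_rev lessThan_iff)
  also have "\<dots> = (\<Sum>k<2 ^ n. kernel_power n i k * kernel_power n k j)"
    by (rule sum.reindex_bij_witness[of _ "bit_rev n" "bit_rev n"])
      (auto simp: bit_rev_less bit_rev_bit_rev)
  also have "\<dots> = (if i = j then 1 else 0)"
    using assms by (rule kernel_power_square)
  finally show ?thesis .
qed

lemma polar_encode_involution:
  assumes "length u = 2 ^ n"
  shows "polar_encode n (polar_encode n u) = u"
proof (rule nth_equalityI)
  fix j assume "j < length (polar_encode n (polar_encode n u))"
  then have j: "j < 2 ^ n"
    by simp
  have "polar_encode n (polar_encode n u) ! j
      = (\<Sum>k<2 ^ n. polar_encode n u ! k * polar_matrix n k j)"
    using j by (subst polar_encode_def) (simp del: length_polar_encode)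
  also have "\<dots> = (\<Sum>k<2 ^ n. (\<Sum>i<2 ^ n. u ! i * polar_matrix n i k) * polar_matrix n k j)"
    by (intro sum.cong arg_cong2[where f = "(*)"]) (simp_all add: polar_encode_def)
  also have "\<dots> = (\<Sum>i<2 ^ n. u ! i * (\<Sum>k<2 ^ n. polar_matrix n i k * polar_matrix n k j))"
    by (rule sum_matrix_assoc)
  also have "\<dots> = (\<Sum>i<2 ^ n. u ! i * (if i = j then 1 else 0))"
    using j by (intro sum.cong arg_cong2[where f = "(*)"] polar_matrix_square) auto
  also have "\<dots> = u ! j"
    using j by (rule sum_delta_mult(2))
  finally show "polar_encode n (polar_encode n u) ! j = u ! j" .
qed (simp add: assms)

text \<open>In the phase basis the circuit acts by the transpose of \<open>G = G\<^sup>-\<^sup>1\<close>, that is, with control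
  and target of every CNOT gate exchanged.\<close>
lemma encode_phase_basis:
  assumes x: "length x = 2 ^ n"
  shows "encode_state n (phase_basis (2 ^ n) v) x = phase_basis (2 ^ n) (phase_encode n v) x"
proof -
  have "{u. length u = 2 ^ n \<and> polar_encode n u = x} = {polar_encode n x}"
    using x by (auto simp: polar_encode_involution)
  moreover have "(\<Sum>i<2 ^ n. polar_encode n x ! i * v ! i)
      = (\<Sum>j<2 ^ n. x ! j * phase_encode n v ! j)" (is "?l = ?r")
  proof -
    have "?l = (\<Sum>i<2 ^ n. (\<Sum>j<2 ^ n. x ! j * polar_matrix n j i) * v ! i)"
      by (intro sum.cong arg_cong2[where f = "(*)"]) (simp_all add: polar_encode_def)
    also have "\<dots> = (\<Sum>j<2 ^ n. x ! j * (\<Sum>i<2 ^ n. polar_matrix n j i * v ! i))"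
      by (rule sum_matrix_assoc)
    also have "\<dots> = ?r"
      by (intro sum.cong arg_cong2[where f = "(*)"]) (simp_all add: phase_encode_def conj_commute)
    finally show ?thesis .
  qed
  ultimately show ?thesis
    by (simp add: encode_state_def phase_basis_def)
qed

definition amplitude_block :: "nat \<Rightarrow> real \<Rightarrow> bit option list \<Rightarrow> bit list \<Rightarrow> real" where
  "amplitude_block n \<epsilon> y u = memoryless (2 ^ n) (amplitude_trans \<epsilon>) y (polar_encode n u)"

definition phase_block :: "nat \<Rightarrow> real \<Rightarrow> bit option list \<Rightarrow> bit list \<Rightarrow> real" where
  "phase_block n \<epsilon> w v = memoryless (2 ^ n) (phase_trans \<epsilon>) w (phase_encode n v)"

definition W_block :: "nat \<Rightarrow> real \<Rightarrow> bit option list \<Rightarrow> bit list \<Rightarrow> real" where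
  "W_block n \<epsilon> y u = memoryless (2 ^ n) (bec \<epsilon>) y (polar_encode n u)"

definition Z_synth :: "nat \<Rightarrow> real \<Rightarrow> nat \<Rightarrow> real" where
  "Z_synth n \<epsilon> i = bhattacharyya (synth_outputs (2 ^ n) i) (synth (2 ^ n) (W_block n \<epsilon>) i)"

definition good_set :: "nat \<Rightarrow> real \<Rightarrow> real \<Rightarrow> nat set" where
  "good_set n \<epsilon> \<eta> = {i \<in> {1..2 ^ n}. Z_synth n \<epsilon> i \<le> \<eta>}"

definition phase_good_set :: "nat \<Rightarrow> real \<Rightarrow> real \<Rightarrow> nat set" where
  "phase_good_set n \<epsilon> \<eta> = (\<lambda>i. 2 ^ n + 1 - i) ` good_set n \<epsilon> \<eta>"

definition upper_U :: "nat \<Rightarrow> real \<Rightarrow> real \<Rightarrow> real" where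
  "upper_U n \<epsilon> \<eta> = (\<Sum>i\<in>good_set n \<epsilon> \<eta>. Z_synth n \<epsilon> i)"

definition lower_L :: "nat \<Rightarrow> real \<Rightarrow> real \<Rightarrow> real" where
  "lower_L n \<epsilon> \<eta> =
     (if good_set n \<epsilon> \<eta> = {} then 0
      else Max ((\<lambda>i. 1 / 2 * (1 - sqrt (1 - (Z_synth n \<epsilon> i)\<^sup>2))) ` good_set n \<epsilon> \<eta>))"

section \<open>Runs of the code and error events\<close>

text \<open>
  In a run \<open>(u, y, v, w)\<close> the encoder inputs have amplitude bits \<open>u\<close> and phase bits \<open>v\<close>, and \<open>y\<close>
  and \<open>w\<close> are the outputs of the induced amplitude and phase channels.  Both are obtained from
  the same \<open>N\<close> channel uses, so they show the same erasure flags.  Amplitude and phase being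
  complementary, nothing else is prescribed about their joint distribution: \<open>polar_run\<close> admits
  every joint law with the given marginals and common flags.
\<close>

type_synonym run = "bit list \<times> bit option list \<times> bit list \<times> bit option list"

definition polar_run :: "nat \<Rightarrow> real \<Rightarrow> run pmf \<Rightarrow> bool" where
  "polar_run n \<epsilon> R \<longleftrightarrow>
     (\<forall>u y. length u = 2 ^ n \<longrightarrow> length y = 2 ^ n \<longrightarrow>
        pmf (map_pmf (\<lambda>(u, y, v, w). (u, y)) R) (u, y) = 1 / 2 ^ 2 ^ n * amplitude_block n \<epsilon> y u) \<and>
     (\<forall>v w. length v = 2 ^ n \<longrightarrow> length w = 2 ^ n \<longrightarrow>
        pmf (map_pmf (\<lambda>(u, y, v, w). (v, w)) R) (v, w) = 1 / 2 ^ 2 ^ n * phase_block n \<epsilon> w v) \<and>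
     (\<forall>(u, y, v, w) \<in> set_pmf R. \<forall>j<2 ^ n. y ! j = None \<longleftrightarrow> w ! j = None)"

definition amplitude_err :: "nat \<Rightarrow> real \<Rightarrow> nat set \<Rightarrow> run set" where
  "amplitude_err n \<epsilon> A =
     {(u, y, v, w). sc_decode (2 ^ n) (amplitude_block n \<epsilon>) A u y \<noteq> u}"

text \<open>Phase decoding proceeds through the inputs \<open>N, N - 1, \<dots>, 1\<close>: it is successive cancellation
  for the reversed word \<open>rev v\<close>, whose \<open>i\<close>-th bit belongs to encoder input \<open>N + 1 - i\<close>.\<close>
definition phase_err :: "nat \<Rightarrow> real \<Rightarrow> nat set \<Rightarrow> run set" where
  "phase_err n \<epsilon> B =
     {(u, y, v, w).
        sc_decode (2 ^ n) (\<lambda>w v'. phase_block n \<epsilon> w (rev v'))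
          {i \<in> {1..2 ^ n}. 2 ^ n + 1 - i \<in> B} (rev v) w \<noteq> rev v}"

definition block_error_prob :: "nat \<Rightarrow> real \<Rightarrow> real \<Rightarrow> run pmf \<Rightarrow> real" where
  "block_error_prob n \<epsilon> \<eta> R =
     (let \<alpha> = amplitude_err n \<epsilon> (good_set n \<epsilon> \<eta>); \<phi> = phase_err n \<epsilon> (phase_good_set n \<epsilon> \<eta>) in
      measure_pmf.prob R \<alpha> + measure_pmf.prob R \<phi> - measure_pmf.prob R (\<alpha> \<inter> \<phi>))"

subsection \<open>Existence of runs\<close>

definition erase :: "bool list \<Rightarrow> bit list \<Rightarrow> bit option list" where
  "erase F x = map2 (\<lambda>f b. if f then None else Some b) F x"

lemma pmf_erase:
  assumes "\<epsilon> \<in> {0..1}" "length y = length x"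
  shows "pmf (map_pmf (\<lambda>F. erase F x) (replicate_pmf (length x) (bernoulli_pmf \<epsilon>))) y
    = memoryless (length x) (bec \<epsilon>) y x"
  using assms(2)
proof (induction x arbitrary: y)
  case Nil
  then show ?case
    by (simp add: memoryless_def erase_def)
next
  case (Cons b x)
  then obtain c z where y: "y = c # z" and z: "length z = length x"
    by (cases y) auto
  let ?p = "map_pmf (\<lambda>F. erase F x) (replicate_pmf (length x) (bernoulli_pmf \<epsilon>))"
  have "map_pmf (\<lambda>F. erase F (b # x)) (replicate_pmf (length (b # x)) (bernoulli_pmf \<epsilon>))
      = bind_pmf (bernoulli_pmf \<epsilon>) (\<lambda>f. map_pmf ((#) (if f then None else Some b)) ?p)"
    by (auto simp: map_pmf_def bind_assoc_pmf bind_return_pmf erase_def intro!: bind_pmf_cong)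
  moreover have "pmf (map_pmf ((#) d) ?p) y = (if d = c then pmf ?p z else 0)" for d
  proof (cases "d = c")
    case True
    then show ?thesis
      unfolding y by (subst True, subst pmf_map_inj') (auto intro: injI)
  next
    case False
    then show ?thesis
      unfolding y by (auto intro!: pmf_map_outside)
  qed
  ultimately have "pmf (map_pmf (\<lambda>F. erase F (b # x))
        (replicate_pmf (length (b # x)) (bernoulli_pmf \<epsilon>))) y = bec \<epsilon> c b * pmf ?p z"
    using assms(1) by (auto simp: pmf_bind bec_def split: option.split)
  also have "\<dots> = memoryless (length (b # x)) (bec \<epsilon>) y (b # x)"
    unfolding Cons.IH[OF z] unfolding y
    by (simp add: memoryless_def prod.lessThan_Suc_shift del: prod.lessThan_Suc)
  finally show ?case .
qed

lemma card_bit: "CARD(bit) = 2"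
  by (simp add: UNIV_bit)

lemma finite_words: "finite {u :: bit list. length u = N}"
  using finite_lists_length_eq[of "UNIV :: bit set" N] by simp

lemma card_words: "card {u :: bit list. length u = N} = 2 ^ N"
  using card_lists_length_eq[of "UNIV :: bit set" N] by (simp add: card_bit)

lemma words_nonempty: "{u :: bit list. length u = N} \<noteq> {}"
  using card_words[of N] by (metis card.empty power_not_zero zero_neq_numeral)

lemma pmf_word_erase:
  fixes f :: "bit list \<Rightarrow> bit list"
  assumes "\<epsilon> \<in> {0..1}" "length u = N" "length y = N" "\<And>u. length (f u) = N"
  shows "pmf (bind_pmf (replicate_pmf N (bernoulli_pmf \<epsilon>))
        (\<lambda>F. map_pmf (\<lambda>u. (u, erase F (f u))) (pmf_of_set {u. length u = N}))) (u, y)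
    = 1 / 2 ^ N * memoryless N (bec \<epsilon>) y (f u)"
proof -
  let ?p = "\<lambda>u. map_pmf (\<lambda>F. erase F (f u)) (replicate_pmf N (bernoulli_pmf \<epsilon>))"
  have swap: "bind_pmf (replicate_pmf N (bernoulli_pmf \<epsilon>))
        (\<lambda>F. map_pmf (\<lambda>u. (u, erase F (f u))) (pmf_of_set {u. length u = N}))
      = bind_pmf (pmf_of_set {u. length u = N}) (\<lambda>u. map_pmf (Pair u) (?p u))"
    unfolding map_pmf_def by (subst bind_commute_pmf) (simp add: bind_assoc_pmf bind_return_pmf)
  have point: "pmf (map_pmf (Pair u') (?p u')) (u, y) = (if u' = u then pmf (?p u) y else 0)" for u'
  proof (cases "u' = u")
    case True
    then show ?thesis
      by (subst True, subst pmf_map_inj') (auto intro: injI)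
  next
    case False
    then show ?thesis
      by (auto intro!: pmf_map_outside)
  qed
  have "pmf (?p u) y = memoryless N (bec \<epsilon>) y (f u)"
    using pmf_erase[of \<epsilon> y "f u"] assms by simp
  then show ?thesis
    unfolding swap pmf_bind_pmf_of_set[OF words_nonempty finite_words] point
    using assms(2) by (simp add: finite_words card_words)
qed

lemma polar_run_exists:
  assumes "\<epsilon> \<in> {0..1}"
  shows "\<exists>R. polar_run n \<epsilon> R"
proof -
  define N :: nat where "N = 2 ^ n"
  define words where "words = pmf_of_set {u :: bit list. length u = N}"
  define R where "R = bind_pmf (replicate_pmf N (bernoulli_pmf \<epsilon>)) (\<lambda>F.
      bind_pmf words (\<lambda>u. map_pmf (\<lambda>v. (u, erase F (polar_encode n u), v, erase F (phase_encode n v)))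
        words))"
  have "map_pmf (\<lambda>(u, y, v, w). (u, y)) R = bind_pmf (replicate_pmf N (bernoulli_pmf \<epsilon>))
      (\<lambda>F. map_pmf (\<lambda>u. (u, erase F (polar_encode n u))) words)"
    by (simp add: R_def map_pmf_def bind_assoc_pmf bind_return_pmf)
  moreover have "map_pmf (\<lambda>(u, y, v, w). (v, w)) R = bind_pmf (replicate_pmf N (bernoulli_pmf \<epsilon>))
      (\<lambda>F. map_pmf (\<lambda>v. (v, erase F (phase_encode n v))) words)"
    by (simp add: R_def map_pmf_def bind_assoc_pmf bind_return_pmf)
  moreover have "y ! j = None \<longleftrightarrow> w ! j = None"
    if "(u, y, v, w) \<in> set_pmf R" "j < 2 ^ n" for u y v w j
    using that by (auto simp: R_def N_def erase_def set_replicate_pmf split: if_splits)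
  ultimately show ?thesis
    using assms
    by (intro exI[of _ R])
      (auto simp: polar_run_def amplitude_block_def phase_block_def amplitude_trans_bec
        phase_trans_bec N_def words_def pmf_word_erase)
qed

end

theory Submission
  imports Defs
begin

text \<open>
  For the erasure channel the two likelihoods of a synthesized channel are equal or one of them
  vanishes, so a decision based on the true past fails with probability exactly \<open>Z\<^sub>i / 2\<close>.
  The decoder fails iff one of these decisions does, whence \<open>max Z\<^sub>i / 2 \<le> P \<le> U / 2\<close> for each
  induced channel, the phase one being the amplitude one with all words reversed.
  So \<open>P\<^sub>e \<le> 2 P \<le> U \<le> U (2 - L)\<close> because \<open>L \<le> 1 / 2\<close>.  With \<open>Z\<close> the maximal parameter, \<open>U \<ge> Z\<close>
  and therefore \<open>L (2 - U) \<le> L (2 - Z) \<le> Z / 2 \<le> P \<le> P\<^sub>e\<close>.  Neither bound depends on the joint law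
  of the two error events.
\<close>

section \<open>Successive cancellation with a genie\<close>

definition sc_decision ::
    "nat \<Rightarrow> ('y list \<Rightarrow> bit list \<Rightarrow> real) \<Rightarrow> nat \<Rightarrow> 'y list \<times> bit list \<Rightarrow> bit" where
  "sc_decision N P i o' = (if synth N P i o' 0 \<ge> synth N P i o' 1 then 0 else 1)"

definition genie_err ::
    "nat \<Rightarrow> ('y list \<Rightarrow> bit list \<Rightarrow> real) \<Rightarrow> nat \<Rightarrow> (bit list \<times> 'y list) set" where
  "genie_err N P i = {(u, y). sc_decision N P i (y, take (i - 1) u) \<noteq> u ! (i - 1)}"

lemma length_sc_prefix [simp]: "length (sc_prefix N P A u y k) = k"
  by (induction k) (auto simp: Let_def)

lemma sc_prefix_eq_take_iff:
  assumes "k \<le> length u"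
  shows "sc_prefix N P A u y k = take k u \<longleftrightarrow> (\<forall>i\<in>A \<inter> {1..k}. (u, y) \<notin> genie_err N P i)"
  using assms
proof (induction k)
  case (Suc k)
  have split: "(\<forall>i\<in>A \<inter> {1..Suc k}. Q i) \<longleftrightarrow> (\<forall>i\<in>A \<inter> {1..k}. Q i) \<and> (Suc k \<in> A \<longrightarrow> Q (Suc k))" for Q
    using atLeastAtMostSuc_conv[of 1 k] by auto
  have "sc_prefix N P A u y (Suc k) = take (Suc k) u \<longleftrightarrow>
      sc_prefix N P A u y k = take k u \<and> (Suc k \<in> A \<longrightarrow> sc_decision N P (Suc k) (y, take k u) = u ! k)"
    using Suc.prems by (auto simp: Let_def take_Suc_conv_app_nth sc_decision_def)
  also have "\<dots> \<longleftrightarrow> (\<forall>i\<in>A \<inter> {1..Suc k}. (u, y) \<notin> genie_err N P i)"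
    using Suc unfolding split by (simp add: genie_err_def)
  finally show ?case .
qed auto

lemma sc_decode_eq_iff:
  assumes "length u = N" "A \<subseteq> {1..N}"
  shows "sc_decode N P A u y = u \<longleftrightarrow> (\<forall>i\<in>A. (u, y) \<notin> genie_err N P i)"
  using sc_prefix_eq_take_iff[of N u N P A y] assms
  by (simp add: sc_decode_def Int_absorb2)

lemma sc_prefix_cong:
  assumes "\<And>v. length v = N \<Longrightarrow> P y v = P' y' v" "k \<le> N"
  shows "sc_prefix N P A u y k = sc_prefix N P' A u y' k"
  using assms(2)
proof (induction k)
  case (Suc k)
  have "synth N P (Suc k) (y, p) b = synth N P' (Suc k) (y', p) b" if "length p = k" for p b
    using that Suc.prems by (auto simp: synth_def intro!: sum.cong assms(1))
  then show ?case
    using Suc by (simp add: Let_def)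
qed auto

section \<open>Synthesized erasure channels\<close>

lemma memoryless_bec_nonneg:
  assumes "\<epsilon> \<in> {0..1}"
  shows "memoryless N (bec \<epsilon>) y x \<ge> 0"
  using assms by (auto simp: memoryless_def bec_def intro!: prod_nonneg split: option.split)

lemma bec_translate:
  assumes "bec \<epsilon> y a \<noteq> 0" "bec \<epsilon> y b \<noteq> 0"
  shows "bec \<epsilon> y (x + (a + b)) = bec \<epsilon> y x"
  using assms by (cases y) (auto simp: bec_def split: if_splits)

lemma polar_encode_add:
  assumes "length u = 2 ^ n" "length v = 2 ^ n" "length w = 2 ^ n" "j < 2 ^ n"
  shows "polar_encode n (map2 (+) u (map2 (+) v w)) ! j
    = polar_encode n u ! j + (polar_encode n v ! j + polar_encode n w ! j)"
proof -
  have dist: "(\<Sum>i<m. (a i + (b i + c i)) * g i)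
      = (\<Sum>i<m. a i * g i) + ((\<Sum>i<m. b i * g i) + (\<Sum>i<m. c i * g i))"
    for a b c g :: "nat \<Rightarrow> 'a::comm_semiring_1" and m :: nat
    by (simp add: sum.distrib distrib_right)
  have "polar_encode n (map2 (+) u (map2 (+) v w)) ! j
      = (\<Sum>i<2 ^ n. (u ! i + (v ! i + w ! i)) * polar_matrix n i j)"
    unfolding polar_encode_def using assms
    by (simp only: nth_map_upt diff_zero nth_upt add_0 length_upt nth_map length_map)
      (intro sum.cong arg_cong2[where f = "(*)"], simp_all)
  also have "\<dots> = polar_encode n u ! j + (polar_encode n v ! j + polar_encode n w ! j)"
    unfolding dist using assms(4) by (simp add: polar_encode_def)
  finally show ?thesis .
qed

lemma W_block_translate:
  assumes "length u = 2 ^ n" "length v = 2 ^ n" "length w = 2 ^ n"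
    and "W_block n \<epsilon> y v \<noteq> 0" "W_block n \<epsilon> y w \<noteq> 0"
  shows "W_block n \<epsilon> y (map2 (+) u (map2 (+) v w)) = W_block n \<epsilon> y u"
  unfolding W_block_def memoryless_def
proof (rule prod.cong)
  fix j :: nat assume "j \<in> {..<2 ^ n}"
  then have j: "j < 2 ^ n"
    by simp
  then have "bec \<epsilon> (y ! j) (polar_encode n v ! j) \<noteq> 0" "bec \<epsilon> (y ! j) (polar_encode n w ! j) \<noteq> 0"
    using assms(4,5) by (auto simp: W_block_def memoryless_def)
  then show "bec \<epsilon> (y ! j) (polar_encode n (map2 (+) u (map2 (+) v w)) ! j)
      = bec \<epsilon> (y ! j) (polar_encode n u ! j)"
    unfolding polar_encode_add[OF assms(1-3) j] by (rule bec_translate)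
qed simp

lemma map2_add_self:
  fixes s d :: "bit list"
  assumes "length d = length s"
  shows "map2 (+) (map2 (+) s d) d = s"
  using assms by (intro nth_equalityI) (auto simp: add.assoc)

text \<open>The suffixes compatible with \<open>y\<close>, \<open>p\<close> and either value of the bit form affine spaces over
  the same linear space, hence are equally many when both exist.\<close>
lemma synth_W_block_dichotomy:
  assumes i: "i \<in> {1..2 ^ n}" and p: "length p = i - 1"
  shows "synth (2 ^ n) (W_block n \<epsilon>) i (y, p) 0 = synth (2 ^ n) (W_block n \<epsilon>) i (y, p) 1
    \<or> synth (2 ^ n) (W_block n \<epsilon>) i (y, p) 0 * synth (2 ^ n) (W_block n \<epsilon>) i (y, p) 1 = 0"
proof (cases "synth (2 ^ n) (W_block n \<epsilon>) i (y, p) 0 * synth (2 ^ n) (W_block n \<epsilon>) i (y, p) 1 = 0")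
  case False
  let ?W = "\<lambda>b s. W_block n \<epsilon> y (p @ b # s)"
  have ex: "\<exists>s. length s = 2 ^ n - i \<and> ?W b s \<noteq> 0"
    if "synth (2 ^ n) (W_block n \<epsilon>) i (y, p) b \<noteq> 0" for b
  proof (rule ccontr)
    assume "\<not> (\<exists>s. length s = 2 ^ n - i \<and> ?W b s \<noteq> 0)"
    then have "synth (2 ^ n) (W_block n \<epsilon>) i (y, p) b = 0"
      by (auto simp: synth_def intro!: sum.neutral)
    with that show False
      by contradiction
  qed
  from False ex obtain s0 where s0: "length s0 = 2 ^ n - i" "?W 0 s0 \<noteq> 0"
    by (metis mult_zero_left)
  from False ex obtain s1 where s1: "length s1 = 2 ^ n - i" "?W 1 s1 \<noteq> 0"
    by (metis mult_zero_right)
  define d where "d = map2 (+) s0 s1"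
  have d: "length d = 2 ^ n - i"
    using s0 s1 by (simp add: d_def)
  define T where "T s = map2 (+) s d" for s
  have T: "T (T s) = s" "length (T s) = 2 ^ n - i" if "length s = 2 ^ n - i" for s
    using that d unfolding T_def by (auto intro!: map2_add_self simp only: length_map length_zip min.idem)
  have pp: "map2 (+) p (map2 (+) p p) = p"
    by (intro nth_equalityI) auto
  have step: "?W 1 (T s) = ?W 0 s" if "length s = 2 ^ n - i" for s
  proof -
    have "map2 (+) (p @ 0 # s) (map2 (+) (p @ 0 # s0) (p @ 1 # s1)) = p @ 1 # T s"
      by (simp only: T_def d_def zip_append map_append zip_Cons_Cons list.map prod.case length_map
          length_zip min.idem pp add_0)
    then show ?thesis
      using W_block_translate[of "p @ 0 # s" n "p @ 0 # s0" "p @ 1 # s1" \<epsilon> y] that s0 s1 i p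
      by simp
  qed
  have "(\<Sum>s | length s = 2 ^ n - i. ?W 0 s) = (\<Sum>s | length s = 2 ^ n - i. ?W 1 s)"
    by (rule sum.reindex_bij_witness[of _ T T]) (auto simp: T step)
  then show ?thesis
    by (simp add: synth_def flip: sum_divide_distrib)
qed simp

lemma synth_nonneg:
  assumes "\<epsilon> \<in> {0..1}"
  shows "synth (2 ^ n) (W_block n \<epsilon>) i q b \<ge> 0"
  using assms
  by (cases q) (auto simp: synth_def W_block_def intro!: sum_nonneg divide_nonneg_nonneg memoryless_bec_nonneg)

lemma synth_wrong_decision:
  assumes "\<epsilon> \<in> {0..1}" "i \<in> {1..2 ^ n}" "length p = i - 1"
  shows "synth (2 ^ n) (W_block n \<epsilon>) i (y, p) (sc_decision (2 ^ n) (W_block n \<epsilon>) i (y, p) + 1)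
    = sqrt (synth (2 ^ n) (W_block n \<epsilon>) i (y, p) 0 * synth (2 ^ n) (W_block n \<epsilon>) i (y, p) 1)"
  using synth_W_block_dichotomy[OF assms(2,3), of \<epsilon> y]
    synth_nonneg[OF assms(1), of n i "(y, p)" 0] synth_nonneg[OF assms(1), of n i "(y, p)" 1]
  by (auto simp: sc_decision_def)

section \<open>Error probabilities\<close>

definition block_law :: "nat \<Rightarrow> real \<Rightarrow> (bit list \<times> bit option list) pmf \<Rightarrow> bool" where
  "block_law n \<epsilon> Q \<longleftrightarrow> (\<forall>u y. length u = 2 ^ n \<longrightarrow> length y = 2 ^ n \<longrightarrow>
     pmf Q (u, y) = 1 / 2 ^ 2 ^ n * W_block n \<epsilon> y u)"

definition blocks :: "nat \<Rightarrow> (bit list \<times> bit option list) set" where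
  "blocks N = {u. length u = N} \<times> {y. length y = N}"

lemma finite_outputs: "finite {y :: bit option list. length y = N}"
  using finite_lists_length_eq[of "UNIV :: bit option set" N] by simp

lemma finite_blocks: "finite (blocks N)"
  by (simp add: blocks_def finite_words finite_outputs)

lemma set_pmf_block_law:
  assumes "\<epsilon> \<in> {0..1}" "block_law n \<epsilon> Q"
  shows "set_pmf Q \<subseteq> blocks (2 ^ n)"
proof -
  define M where "M = bind_pmf (replicate_pmf (2 ^ n) (bernoulli_pmf \<epsilon>))
    (\<lambda>F. map_pmf (\<lambda>u. (u, erase F (polar_encode n u))) (pmf_of_set {u. length u = 2 ^ n}))"
  have M: "set_pmf M \<subseteq> blocks (2 ^ n)"
    by (auto simp: M_def blocks_def erase_def set_replicate_pmf set_pmf_of_set[OF words_nonempty finite_words])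
  have "measure_pmf.prob Q (blocks (2 ^ n)) = sum (pmf M) (blocks (2 ^ n))"
    unfolding measure_measure_pmf_finite[OF finite_blocks]
    using assms
    by (intro sum.cong)
      (auto simp: blocks_def block_law_def M_def pmf_word_erase W_block_def)
  also have "\<dots> = 1"
    by (rule sum_pmf_eq_1[OF finite_blocks M])
  finally show ?thesis
    by (auto simp: measure_pmf.prob_eq_1 AE_measure_pmf_iff)
qed

lemma prob_block_law:
  assumes "\<epsilon> \<in> {0..1}" "block_law n \<epsilon> Q"
  shows "measure_pmf.prob Q E
    = (\<Sum>(u, y)\<in>blocks (2 ^ n). if (u, y) \<in> E then 1 / 2 ^ 2 ^ n * W_block n \<epsilon> y u else 0)"
proof -
  have "measure_pmf.prob Q E = measure_pmf.prob Q (E \<inter> blocks (2 ^ n))"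
    using set_pmf_block_law[OF assms]
    by (intro measure_prob_cong_0) (auto simp: set_pmf_iff)
  also have "\<dots> = (\<Sum>q\<in>blocks (2 ^ n). if q \<in> E then pmf Q q else 0)"
    by (simp add: measure_measure_pmf_finite finite_blocks sum.inter_restrict Int_commute[of E])
  also have "\<dots> = (\<Sum>(u, y)\<in>blocks (2 ^ n). if (u, y) \<in> E then 1 / 2 ^ 2 ^ n * W_block n \<epsilon> y u else 0)"
    using assms(2) by (intro sum.cong) (auto simp: blocks_def block_law_def)
  finally show ?thesis .
qed

lemma sum_split_word:
  fixes g :: "bit list \<Rightarrow> 'a::comm_monoid_add"
  assumes "i \<in> {1..N}"
  shows "(\<Sum>u | length u = N. g u)
    = (\<Sum>p | length p = i - 1. \<Sum>b\<in>UNIV. \<Sum>s | length s = N - i. g (p @ b # s))"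
proof -
  have recombine: "take (i - 1) u @ u ! (i - 1) # drop i u = u" if "length u = N" for u :: "bit list"
  proof -
    have "i - 1 < length u" "Suc (i - 1) = i"
      using that assms by auto
    then show ?thesis
      using id_take_nth_drop[of "i - 1" u] by simp
  qed
  have "(\<Sum>u | length u = N. g u)
      = (\<Sum>(p, b, s)\<in>{p. length p = i - 1} \<times> UNIV \<times> {s. length s = N - i}. g (p @ b # s))"
    using assms recombine
    by (intro sum.reindex_bij_witness[of _ "\<lambda>(p, b, s). p @ b # s"
          "\<lambda>u. (take (i - 1) u, u ! (i - 1), drop i u)"])
      (auto simp: nth_append)
  then show ?thesis
    by (simp add: sum.cartesian_product case_prod_unfold)
qed

lemma prob_genie_err:
  assumes \<epsilon>: "\<epsilon> \<in> {0..1}" and Q: "block_law n \<epsilon> Q" and i: "i \<in> {1..2 ^ n}"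
  shows "measure_pmf.prob Q (genie_err (2 ^ n) (W_block n \<epsilon>) i) = Z_synth n \<epsilon> i / 2"
proof -
  let ?N = "2 ^ n :: nat" and ?W = "W_block n \<epsilon>"
  let ?d = "\<lambda>y p. sc_decision ?N ?W i (y, p)"
  let ?f = "\<lambda>u y. if (u, y) \<in> genie_err ?N ?W i then 1 / 2 ^ ?N * ?W y u else 0"
  have pw: "(2::real) ^ ?N = 2 * 2 ^ (?N - 1)"
    by (simp flip: power_Suc)
  have inner: "(\<Sum>b\<in>UNIV. \<Sum>s | length s = ?N - i. ?f (p @ b # s) y)
      = sqrt (synth ?N ?W i (y, p) 0 * synth ?N ?W i (y, p) 1) / 2"
    if p: "length p = i - 1" for p y
  proof -
    have "(\<Sum>s | length s = ?N - i. ?f (p @ b # s) y)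
        = (if b = ?d y p + 1 then synth ?N ?W i (y, p) b / 2 else 0)" for b
    proof -
      have "(p @ b # s, y) \<in> genie_err ?N ?W i \<longleftrightarrow> b = ?d y p + 1" for s
        using p by (cases b; cases "?d y p") (auto simp: genie_err_def nth_append)
      then show ?thesis
        by (auto simp: synth_def pw sum_divide_distrib intro!: sum.cong)
    qed
    then show ?thesis
      using synth_wrong_decision[OF \<epsilon> i p, of y] by simp
  qed
  have "measure_pmf.prob Q (genie_err ?N ?W i) = (\<Sum>y | length y = ?N. \<Sum>u | length u = ?N. ?f u y)"
    unfolding prob_block_law[OF \<epsilon> Q] blocks_def sum.cartesian_product[symmetric]
    by (rule sum.swap)
  also have "\<dots> = (\<Sum>y | length y = ?N. \<Sum>p | length p = i - 1.
      sqrt (synth ?N ?W i (y, p) 0 * synth ?N ?W i (y, p) 1) / 2)"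
    unfolding sum_split_word[OF i] by (intro sum.cong refl inner) simp
  also have "\<dots> = Z_synth n \<epsilon> i / 2"
    by (simp add: Z_synth_def bhattacharyya_def synth_outputs_def sum.cartesian_product
        case_prod_unfold flip: sum_divide_distrib)
  finally show ?thesis .
qed

lemma sc_error_bounds:
  assumes \<epsilon>: "\<epsilon> \<in> {0..1}" and Q: "block_law n \<epsilon> Q" and A: "A \<subseteq> {1..2 ^ n}"
  defines "E \<equiv> {(u, y). sc_decode (2 ^ n) (W_block n \<epsilon>) A u y \<noteq> u}"
  shows "measure_pmf.prob Q E \<le> (\<Sum>i\<in>A. Z_synth n \<epsilon> i) / 2"
    and "i \<in> A \<Longrightarrow> Z_synth n \<epsilon> i / 2 \<le> measure_pmf.prob Q E"
proof -
  let ?G = "genie_err (2 ^ n) (W_block n \<epsilon>)"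
  have fin: "finite A"
    by (rule finite_subset[OF A]) simp
  have "(u, y) \<in> E \<longleftrightarrow> (u, y) \<in> (\<Union>i\<in>A. ?G i)" if "length u = 2 ^ n" for u y
    using sc_decode_eq_iff[OF that A, of "W_block n \<epsilon>" y] by (simp add: E_def)
  then have eq: "measure_pmf.prob Q E = measure_pmf.prob Q (\<Union>i\<in>A. ?G i)"
    using set_pmf_block_law[OF \<epsilon> Q]
    by (intro measure_pmf.finite_measure_eq_AE) (fastforce simp: AE_measure_pmf_iff blocks_def)+
  have "measure_pmf.prob Q (\<Union>i\<in>A. ?G i) \<le> (\<Sum>i\<in>A. measure_pmf.prob Q (?G i))"
    using fin by (intro measure_pmf.finite_measure_subadditive_finite) auto
  also have "\<dots> = (\<Sum>i\<in>A. Z_synth n \<epsilon> i / 2)"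
    using A by (intro sum.cong prob_genie_err[OF \<epsilon> Q]) auto
  finally show "measure_pmf.prob Q E \<le> (\<Sum>i\<in>A. Z_synth n \<epsilon> i) / 2"
    unfolding eq by (simp add: sum_divide_distrib)
  show "Z_synth n \<epsilon> i / 2 \<le> measure_pmf.prob Q E" if "i \<in> A"
  proof -
    have "Z_synth n \<epsilon> i / 2 = measure_pmf.prob Q (?G i)"
      using that A by (intro prob_genie_err[OF \<epsilon> Q, symmetric]) auto
    also have "\<dots> \<le> measure_pmf.prob Q (\<Union>i\<in>A. ?G i)"
      using that by (intro measure_pmf.finite_measure_mono) auto
    finally show ?thesis
      unfolding eq .
  qed
qed

section \<open>The phase channel as the reversed amplitude channel\<close>

lemma bit_complement:
  "b < n \<Longrightarrow> i < 2 ^ n \<Longrightarrow> bit (2 ^ n - Suc i) b \<longleftrightarrow> \<not> bit i b"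
proof (induction n arbitrary: b i)
  case (Suc n)
  have "(2 ^ Suc n - Suc i) div 2 = 2 ^ n - Suc (i div 2)"
    using Suc.prems by simp
  moreover have "odd (2 ^ Suc n - Suc i) \<longleftrightarrow> even i"
    using Suc.prems by (simp add: Suc_le_eq)
  moreover have "i div 2 < 2 ^ n"
    using Suc.prems by auto
  ultimately show ?case
    using Suc.IH[of "b - 1" "i div 2"] Suc.prems
    by (cases b) (auto simp: bit_0 bit_Suc simp del: power_Suc)
qed simp

lemma polar_matrix_complement:
  assumes "i < 2 ^ n" "j < 2 ^ n"
  shows "polar_matrix n j (2 ^ n - Suc i) = polar_matrix n i (2 ^ n - Suc j)"
proof -
  have "(\<forall>b<n. \<not> bit i b \<longrightarrow> bit j (n - Suc b)) \<longleftrightarrow> (\<forall>b<n. \<not> bit j b \<longrightarrow> bit i (n - Suc b))"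
    by (auto dest: spec[of _ "n - Suc _"])
  then show ?thesis
    using assms
    by (simp add: polar_matrix_eq kernel_power_bits bit_rev_less bit_bit_rev bit_complement)
qed

lemma phase_encode_rev:
  assumes "length v = 2 ^ n"
  shows "phase_encode n (rev v) = rev (polar_encode n v)"
proof (rule nth_equalityI)
  fix j assume "j < length (phase_encode n (rev v))"
  then have j: "j < 2 ^ n"
    by simp
  have "phase_encode n (rev v) ! j = (\<Sum>i<2 ^ n. rev v ! i * polar_matrix n j i)"
    using j by (simp add: phase_encode_def)
  also have "\<dots> = (\<Sum>i<2 ^ n. rev v ! (2 ^ n - Suc i) * polar_matrix n j (2 ^ n - Suc i))"
    by (rule sum.nat_diff_reindex[symmetric])
  also have "\<dots> = (\<Sum>i<2 ^ n. v ! i * polar_matrix n i (2 ^ n - Suc j))"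
    using j assms
    by (intro sum.cong arg_cong2[where f = "(*)"]) (auto simp: rev_nth polar_matrix_complement)
  also have "\<dots> = rev (polar_encode n v) ! j"
    using j by (simp add: rev_nth polar_encode_def)
  finally show "phase_encode n (rev v) ! j = rev (polar_encode n v) ! j" .
qed simp

lemma memoryless_rev:
  assumes "length y = N" "length x = N"
  shows "memoryless N V (rev y) (rev x) = memoryless N V y x"
proof -
  have "memoryless N V (rev y) (rev x) = (\<Prod>j<N. V (y ! (N - Suc j)) (x ! (N - Suc j)))"
    unfolding memoryless_def using assms by (intro prod.cong) (auto simp: rev_nth)
  also have "\<dots> = memoryless N V y x"
    unfolding memoryless_def by (rule prod.nat_diff_reindex)
  finally show ?thesis .
qed

lemma phase_block_rev:
  assumes "length v = 2 ^ n" "length w = 2 ^ n"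
  shows "phase_block n \<epsilon> w (rev v) = W_block n \<epsilon> (rev w) v"
  using assms memoryless_rev[of "rev w" "2 ^ n" "polar_encode n v" "bec \<epsilon>"]
  by (simp add: phase_block_def W_block_def phase_trans_bec phase_encode_rev)

lemma amplitude_block_eq: "amplitude_block n \<epsilon> = W_block n \<epsilon>"
  by (intro ext) (simp add: amplitude_block_def W_block_def amplitude_trans_bec)

lemma good_set_subset: "good_set n \<epsilon> \<eta> \<subseteq> {1..2 ^ n}"
  by (auto simp: good_set_def)

lemma reversed_phase_good_set:
  "{i \<in> {1..2 ^ n}. 2 ^ n + 1 - i \<in> phase_good_set n \<epsilon> \<eta>} = good_set n \<epsilon> \<eta>"
proof -
  have "i \<in> good_set n \<epsilon> \<eta>"
    if "i \<in> {1..2 ^ n}" "2 ^ n + 1 - i = 2 ^ n + 1 - k" "k \<in> good_set n \<epsilon> \<eta>" for i k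
  proof -
    have "k \<in> {1..2 ^ n}"
      using that(3) good_set_subset by blast
    then have "i = k"
      using that(1,2) by auto
    then show ?thesis
      using that(3) by simp
  qed
  then show ?thesis
    using good_set_subset by (fastforce simp: phase_good_set_def)
qed

lemma polar_run_amplitude_law:
  assumes "polar_run n \<epsilon> R"
  shows "block_law n \<epsilon> (map_pmf (\<lambda>(u, y, v, w). (u, y)) R)"
  using assms by (simp add: polar_run_def block_law_def amplitude_block_eq)

lemma polar_run_phase_law:
  assumes "polar_run n \<epsilon> R"
  shows "block_law n \<epsilon> (map_pmf (\<lambda>(u, y, v, w). (rev v, rev w)) R)"
proof -
  let ?Q = "map_pmf (\<lambda>(u, y, v, w). (v, w)) R" and ?r = "\<lambda>(v :: bit list, w :: bit option list). (rev v, rev w)"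
  have inj: "inj ?r"
    by (auto intro!: injI)
  have "map_pmf (\<lambda>(u, y, v, w). (rev v, rev w)) R = map_pmf ?r ?Q"
    by (simp add: pmf.map_comp o_def case_prod_unfold)
  moreover have "pmf (map_pmf ?r ?Q) (v, w) = pmf ?Q (rev v, rev w)" for v w
    using pmf_map_inj'[OF inj, of ?Q "(rev v, rev w)"] by simp
  ultimately show ?thesis
    using assms phase_block_rev[of _ n "rev _" \<epsilon>]
    by (simp add: polar_run_def block_law_def)
qed

lemma amplitude_err_vimage:
  "amplitude_err n \<epsilon> A
    = (\<lambda>(u, y, v, w). (u, y)) -` {(u, y). sc_decode (2 ^ n) (W_block n \<epsilon>) A u y \<noteq> u}"
  by (auto simp: amplitude_err_def amplitude_block_eq)

lemma prob_phase_err: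
  assumes \<epsilon>: "\<epsilon> \<in> {0..1}" and R: "polar_run n \<epsilon> R"
  shows "measure_pmf.prob R (phase_err n \<epsilon> (phase_good_set n \<epsilon> \<eta>))
    = measure_pmf.prob (map_pmf (\<lambda>(u, y, v, w). (rev v, rev w)) R)
        {(u, y). sc_decode (2 ^ n) (W_block n \<epsilon>) (good_set n \<epsilon> \<eta>) u y \<noteq> u}"
proof -
  have "length w = 2 ^ n" if "(u, y, v, w) \<in> set_pmf R" for u y v w
    using that set_pmf_block_law[OF \<epsilon> polar_run_phase_law[OF R]]
    by (force simp: blocks_def)
  moreover have "sc_decode (2 ^ n) (\<lambda>w v'. phase_block n \<epsilon> w (rev v')) A (rev v) w
      = sc_decode (2 ^ n) (W_block n \<epsilon>) A (rev v) (rev w)" if "length w = 2 ^ n" for A v w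
    unfolding sc_decode_def using that by (intro sc_prefix_cong) (auto simp: phase_block_rev)
  ultimately show ?thesis
    unfolding measure_map_pmf phase_err_def reversed_phase_good_set
    by (intro measure_pmf.finite_measure_eq_AE) (auto simp: AE_measure_pmf_iff)
qed

section \<open>The block error probability\<close>

lemma Z_synth_nonneg: "\<epsilon> \<in> {0..1} \<Longrightarrow> Z_synth n \<epsilon> i \<ge> 0"
  by (auto simp: Z_synth_def bhattacharyya_def intro!: sum_nonneg mult_nonneg_nonneg synth_nonneg)

lemma half_one_minus_sqrt_bounds:
  fixes z :: real
  assumes "0 \<le> z" "z \<le> 1"
  defines "l \<equiv> 1 / 2 * (1 - sqrt (1 - z\<^sup>2))"
  shows "0 \<le> l" "l \<le> 1 / 2" "l * (2 - z) \<le> z / 2"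
proof -
  define s where "s = sqrt (1 - z\<^sup>2)"
  have z2: "z\<^sup>2 \<le> 1"
    using assms by (simp add: power_le_one)
  then have s: "0 \<le> s" "s \<le> 1" and s2: "s\<^sup>2 = 1 - z\<^sup>2"
    by (auto simp: s_def)
  then show "0 \<le> l" "l \<le> 1 / 2"
    by (auto simp: l_def s_def)
  have "(1 - s) * (2 - z) * (1 + s) = z * (z * (2 - z))"
    using s2 by algebra
  also have "\<dots> \<le> z * (1 + s)"
  proof (intro mult_left_mono)
    have "z * (2 - z) = 1 - (1 - z)\<^sup>2"
      by (simp add: power2_eq_square algebra_simps)
    then show "z * (2 - z) \<le> 1 + s"
      using s by (smt (verit) zero_le_power2)
  qed (use assms in auto)
  finally have "(1 - s) * (2 - z) \<le> z"
    using s by (simp add: mult_le_cancel_right)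
  then show "l * (2 - z) \<le> z / 2"
    by (simp add: l_def s_def)
qed

theorem theorem2:
  fixes n :: nat and \<epsilon> \<eta> :: real and R :: "run pmf"
  assumes "0 \<le> \<epsilon>" and "\<epsilon> \<le> 1" and "0 \<le> \<eta>" and "\<eta> \<le> 1"
    and "polar_run n \<epsilon> R"
  shows "lower_L n \<epsilon> \<eta> * (2 - upper_U n \<epsilon> \<eta>) \<le> block_error_prob n \<epsilon> \<eta> R \<and>
         block_error_prob n \<epsilon> \<eta> R \<le> upper_U n \<epsilon> \<eta> * (2 - lower_L n \<epsilon> \<eta>)"
proof -
  let ?A = "good_set n \<epsilon> \<eta>" and ?Z = "Z_synth n \<epsilon>"
  let ?U = "upper_U n \<epsilon> \<eta>" and ?L = "lower_L n \<epsilon> \<eta>" and ?Pe = "block_error_prob n \<epsilon> \<eta> R"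
  define a where "a = amplitude_err n \<epsilon> ?A"
  define f where "f = phase_err n \<epsilon> (phase_good_set n \<epsilon> \<eta>)"
  have \<epsilon>: "\<epsilon> \<in> {0..1}"
    using assms by simp
  have fin: "finite ?A"
    by (rule finite_subset[OF good_set_subset]) simp
  have Pe: "?Pe = measure_pmf.prob R a + measure_pmf.prob R f - measure_pmf.prob R (a \<inter> f)"
    by (simp add: block_error_prob_def a_def f_def Let_def)
  note amp = sc_error_bounds[OF \<epsilon> polar_run_amplitude_law[OF assms(5)] good_set_subset]
  have prob_a: "measure_pmf.prob R a = measure_pmf.prob (map_pmf (\<lambda>(u, y, v, w). (u, y)) R)
      {(u, y). sc_decode (2 ^ n) (W_block n \<epsilon>) ?A u y \<noteq> u}"
    by (simp add: a_def amplitude_err_vimage)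
  have a_le: "measure_pmf.prob R a \<le> ?U / 2"
    unfolding prob_a upper_U_def by (rule amp(1))
  have a_ge: "?Z i / 2 \<le> measure_pmf.prob R a" if "i \<in> ?A" for i
    unfolding prob_a using that by (rule amp(2))
  have f_le: "measure_pmf.prob R f \<le> ?U / 2"
    unfolding f_def prob_phase_err[OF \<epsilon> assms(5)] upper_U_def
    by (rule sc_error_bounds(1)[OF \<epsilon> polar_run_phase_law[OF assms(5)] good_set_subset])
  have U0: "?U \<ge> 0"
    by (simp add: upper_U_def sum_nonneg Z_synth_nonneg[OF \<epsilon>])
  have Pe_ge: "measure_pmf.prob R a \<le> ?Pe"
    unfolding Pe using measure_pmf.finite_measure_mono[of "a \<inter> f" f R] by simp
  have "?L \<le> 1 / 2 \<and> ?L * (2 - ?U) \<le> ?Pe"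
  proof (cases "?A = {}")
    case True
    then show ?thesis
      using order_trans[OF measure_nonneg Pe_ge] by (simp add: lower_L_def)
  next
    case False
    then have "?L \<in> (\<lambda>i. 1 / 2 * (1 - sqrt (1 - (?Z i)\<^sup>2))) ` ?A"
      unfolding lower_L_def using fin by (simp only: if_False) (intro Max_in, auto)
    then obtain i where i: "i \<in> ?A" and L: "?L = 1 / 2 * (1 - sqrt (1 - (?Z i)\<^sup>2))"
      by blast
    have z: "0 \<le> ?Z i" "?Z i \<le> 1"
      using i assms(4) Z_synth_nonneg[OF \<epsilon>] by (auto simp: good_set_def)
    have "?Z i \<le> ?U"
      unfolding upper_U_def using i fin by (intro member_le_sum) (auto simp: Z_synth_nonneg[OF \<epsilon>])
    then have "?L * (2 - ?U) \<le> ?L * (2 - ?Z i)"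
      using half_one_minus_sqrt_bounds(1)[OF z] unfolding L by (intro mult_left_mono) auto
    also have "\<dots> \<le> ?Z i / 2"
      unfolding L by (rule half_one_minus_sqrt_bounds(3)[OF z])
    also have "\<dots> \<le> ?Pe"
      using a_ge[OF i] Pe_ge by linarith
    finally show ?thesis
      using half_one_minus_sqrt_bounds(2)[OF z, folded L] by blast
  qed
  moreover have "?Pe \<le> ?U * (2 - ?L)"
  proof -
    have "?Pe \<le> ?U * 1"
      unfolding Pe using a_le f_le measure_nonneg[of R "a \<inter> f"] by linarith
    also have "\<dots> \<le> ?U * (2 - ?L)"
      using U0 \<open>?L \<le> 1 / 2 \<and> _\<close> by (intro mult_left_mono) auto
    finally show ?thesis .
  qed
  ultimately show ?thesis
    by blast
qed

end
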